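(* Let $(M,d_g)$ be a Riemannian manifold, where $d_g$ is the metric (distance) induced by the Riemannian inner product $g$. Let $\mu$ be a continuous measure on $M$ such that every closed ball has finite $\mu$-measure and such that $\operatorname{supp}(\mu)$ contains a (nonconstant) geodesic curve. Then there exists a function $f\in L^1(\mu)$ such that $M_\mu f(x)\ne M^c_\mu f(x)$ for at least one point $x\in\operatorname{supp}(\mu)$.
   Context: Measures are positive Borel measures. A measure $\mu$ is continuous if $\mu(\{x\})=0$ for every point $x$. $\operatorname{supp}(\mu)$ is the set of points all of whose open neighbourhoods have positive $\mu$-measure. A ball means a closed ball $B(x,r)=\{y\in M: d_g(x,y)\le r\}$ with $r>0$. For $f\in L^1(\mu)$ and $x\in\operatorname{supp}(\mu)$, the centered and non-centered Hardy–Littlewood maximal functions are $$M^c_\mu f(x)=\sup_{r>0}\frac{1}{\mu(B(x,r))}\int_{B(x,r)} f\,d\mu,\qquad M_\mu f(x)=\sup_{B:\,B\ni x}\frac{1}{\mu(B)}\int_B f\,d\mu,$$ where the second supremum is over all balls $B$ containing $x$, and the average $\frac1{\mu(B)}\int_B f\,d\mu$ is taken to be $0$ if $\mu(B)=0$. *)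

theory Defs
  imports "HOL-Analysis.Analysis"
begin

(* Intended for open S.  C^k is expressed by iterated directional derivatives. *)
primrec Ck_on :: "nat \<Rightarrow> 'e set \<Rightarrow> ('e::euclidean_space \<Rightarrow> 'b::real_normed_vector) \<Rightarrow> bool" where
  "Ck_on 0 S f \<longleftrightarrow> continuous_on S f"
| "Ck_on (Suc k) S f \<longleftrightarrow>
     (\<forall>x\<in>S. f differentiable (at x)) \<and>
     (\<forall>v. Ck_on k S (\<lambda>x. frechet_derivative f (at x) v))"

definition smooth_on :: "'e set \<Rightarrow> ('e::euclidean_space \<Rightarrow> 'b::real_normed_vector) \<Rightarrow> bool" where
  "smooth_on S f \<longleftrightarrow> (\<forall>k. Ck_on k S f)"

(* A chart (U, \<phi>) consists of its domain and its coordinate map into the model space 'e;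
   only the values of \<phi> on U are relevant. *)
type_synonym ('a, 'e) chart = "'a set \<times> ('a \<Rightarrow> 'e)"

definition chart_inv :: "('a, 'e) chart \<Rightarrow> 'e \<Rightarrow> 'a" where
  "chart_inv c = inv_into (fst c) (snd c)"

definition chart_image :: "('a, 'e) chart \<Rightarrow> 'e set" where
  "chart_image c = snd c ` fst c"

definition transition :: "('a, 'e) chart \<Rightarrow> ('a, 'e) chart \<Rightarrow> 'e \<Rightarrow> 'e" where
  "transition c d = snd d \<circ> chart_inv c"

(* The manifold is the whole type 'a, and its dimension is DIM('e).  A (0,2)-tensor field G is
   given by its components: G c p v w is the value at the point p on the two tangent vectors
   whose coordinates in the chart c are v and w. *)
type_synonym ('a, 'e) metric_field = "('a, 'e) chart \<Rightarrow> 'a \<Rightarrow> 'e \<Rightarrow> 'e \<Rightarrow> real"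

locale smooth_manifold =
  fixes A :: "('a::{t2_space,second_countable_topology}, 'e::euclidean_space) chart set"
  assumes charts_cover: "(\<Union>c\<in>A. fst c) = UNIV"
    and open_domain: "c \<in> A \<Longrightarrow> open (fst c)"
    and open_image: "c \<in> A \<Longrightarrow> open (chart_image c)"
    and chart_homeomorphism:
      "c \<in> A \<Longrightarrow> homeomorphism (fst c) (chart_image c) (snd c) (chart_inv c)"
    and smooth_transition:
      "c \<in> A \<Longrightarrow> d \<in> A \<Longrightarrow> smooth_on (snd c ` (fst c \<inter> fst d)) (transition c d)"

locale riemannian_manifold = smooth_manifold A
  for A :: "('a::{t2_space,second_countable_topology}, 'e::euclidean_space) chart set" +
  fixes G :: "('a, 'e) metric_field"
  assumes metric_bilinear: "c \<in> A \<Longrightarrow> p \<in> fst c \<Longrightarrow> bilinear (G c p)"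
    and metric_symmetric: "c \<in> A \<Longrightarrow> p \<in> fst c \<Longrightarrow> G c p v w = G c p w v"
    and metric_positive: "c \<in> A \<Longrightarrow> p \<in> fst c \<Longrightarrow> v \<noteq> 0 \<Longrightarrow> G c p v v > 0"
    and metric_smooth: "c \<in> A \<Longrightarrow> smooth_on (chart_image c) (\<lambda>x. G c (chart_inv c x) v w)"
    and metric_transform:
      "c \<in> A \<Longrightarrow> d \<in> A \<Longrightarrow> p \<in> fst c \<Longrightarrow> p \<in> fst d \<Longrightarrow>
        G c p v w =
          G d p (frechet_derivative (transition c d) (at (snd c p)) v)
                (frechet_derivative (transition c d) (at (snd c p)) w)"

(* Derivatives at the end points a and b are one-sided, and the velocity is continuous up to
   them; hence the speed of a piecewise C^1 curve is bounded and integrable. *)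
definition C1_curve ::
  "('a::topological_space, 'e::euclidean_space) chart set \<Rightarrow> real \<Rightarrow> real \<Rightarrow> (real \<Rightarrow> 'a) \<Rightarrow> bool" where
  "C1_curve A a b \<gamma> \<longleftrightarrow>
     continuous_on {a..b} \<gamma> \<and>
     (\<forall>c\<in>A. \<exists>V. continuous_on ({a..b} \<inter> \<gamma> -` fst c) V \<and>
        (\<forall>t \<in> {a..b} \<inter> \<gamma> -` fst c.
           ((snd c \<circ> \<gamma>) has_vector_derivative V t) (at t within {a..b})))"

definition piecewise_C1_curve ::
  "('a::topological_space, 'e::euclidean_space) chart set \<Rightarrow> real \<Rightarrow> real \<Rightarrow> (real \<Rightarrow> 'a) \<Rightarrow> bool" where
  "piecewise_C1_curve A a b \<gamma> \<longleftrightarrow>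
     continuous_on {a..b} \<gamma> \<and>
     (\<exists>P. finite P \<and>
        (\<forall>s t. a \<le> s \<and> s < t \<and> t \<le> b \<and> {s<..<t} \<inter> P = {} \<longrightarrow> C1_curve A s t \<gamma>))"

(* On a Riemannian manifold this does not depend on the chart chosen around \<gamma> t.  At the
   finitely many break points of a piecewise C^1 curve the value is irrelevant. *)
definition speed ::
  "('a, 'e::euclidean_space) chart set \<Rightarrow> ('a, 'e) metric_field \<Rightarrow> (real \<Rightarrow> 'a) \<Rightarrow> real \<Rightarrow> real" where
  "speed A G \<gamma> t =
     (let c = (SOME c. c \<in> A \<and> \<gamma> t \<in> fst c);
          v = vector_derivative (snd c \<circ> \<gamma>) (at t)
      in sqrt (G c (\<gamma> t) v v))"

definition curve_length ::
  "('a, 'e::euclidean_space) chart set \<Rightarrow> ('a, 'e) metric_field \<Rightarrow> real \<Rightarrow> real \<Rightarrow> (real \<Rightarrow> 'a) \<Rightarrow> real" where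
  "curve_length A G a b \<gamma> = integral {a..b} (speed A G \<gamma>)"

(* Extended-valued: the distance between points in different connected components is \<infinity>;
   on a connected manifold it is finite. *)
definition riemannian_dist ::
  "('a::topological_space, 'e::euclidean_space) chart set \<Rightarrow> ('a, 'e) metric_field \<Rightarrow> 'a \<Rightarrow> 'a \<Rightarrow> ennreal" where
  "riemannian_dist A G x y =
     Inf {ennreal (curve_length A G a b \<gamma>) | a b \<gamma>.
            a \<le> b \<and> piecewise_C1_curve A a b \<gamma> \<and> \<gamma> a = x \<and> \<gamma> b = y}"

definition riemannian_ball ::
  "('a::topological_space, 'e::euclidean_space) chart set \<Rightarrow> ('a, 'e) metric_field \<Rightarrow> 'a \<Rightarrow> real \<Rightarrow> 'a set" where
  "riemannian_ball A G x r = {y. riemannian_dist A G x y \<le> ennreal r}"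

definition metric_coords :: "('a, 'e) metric_field \<Rightarrow> ('a, 'e) chart \<Rightarrow> 'e \<Rightarrow> 'e \<Rightarrow> 'e \<Rightarrow> real" where
  "metric_coords G c x v w = G c (chart_inv c x) v w"

(* Derivative of the metric coefficient g(v, w) at x in direction u. *)
definition metric_deriv ::
  "('a, 'e::euclidean_space) metric_field \<Rightarrow> ('a, 'e) chart \<Rightarrow> 'e \<Rightarrow> 'e \<Rightarrow> 'e \<Rightarrow> 'e \<Rightarrow> real" where
  "metric_deriv G c x u v w = frechet_derivative (\<lambda>y. metric_coords G c y v w) (at x) u"

(* The vector \<Sum>ijk \<Gamma>^k_ij u^i v^j e_k of the Levi-Civita connection, determined by the Koszul
   formula  2 g(\<Gamma>(u,v), w) = \<partial>_u g(v,w) + \<partial>_v g(u,w) - \<partial>_w g(u,v). *)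
definition christoffel ::
  "('a, 'e::euclidean_space) metric_field \<Rightarrow> ('a, 'e) chart \<Rightarrow> 'e \<Rightarrow> 'e \<Rightarrow> 'e \<Rightarrow> 'e" where
  "christoffel G c x u v =
     (THE z. \<forall>w. metric_coords G c x z w =
        (metric_deriv G c x u v w + metric_deriv G c x v u w - metric_deriv G c x w u v) / 2)"

(* The geodesic equation x'' + \<Gamma>(x', x') = 0 in every chart; J is an interval, and derivatives
   at end points belonging to J are one-sided. *)
definition geodesic_on ::
  "('a::topological_space, 'e::euclidean_space) chart set \<Rightarrow> ('a, 'e) metric_field \<Rightarrow>
     real set \<Rightarrow> (real \<Rightarrow> 'a) \<Rightarrow> bool" where
  "geodesic_on A G J \<gamma> \<longleftrightarrow>
     continuous_on J \<gamma> \<and>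
     (\<forall>c\<in>A. \<exists>V W. \<forall>t \<in> J \<inter> \<gamma> -` fst c.
        ((snd c \<circ> \<gamma>) has_vector_derivative V t) (at t within J) \<and>
        (V has_vector_derivative W t) (at t within J) \<and>
        W t + christoffel G c (snd c (\<gamma> t)) (V t) (V t) = 0)"

definition continuous_measure :: "'a measure \<Rightarrow> bool" where
  "continuous_measure \<mu> \<longleftrightarrow> (\<forall>x. emeasure \<mu> {x} = 0)"

definition measure_support :: "'a::topological_space measure \<Rightarrow> 'a set" where
  "measure_support \<mu> = {x. \<forall>U. open U \<and> x \<in> U \<longrightarrow> emeasure \<mu> U > 0}"

(* For sets of finite measure; division by zero gives 0 on null sets. *)
definition average :: "'a measure \<Rightarrow> ('a \<Rightarrow> real) \<Rightarrow> 'a set \<Rightarrow> real" where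
  "average \<mu> f B = (LINT y:B|\<mu>. f y) / measure \<mu> B"

definition centered_maximal ::
  "('a::topological_space, 'e::euclidean_space) chart set \<Rightarrow> ('a, 'e) metric_field \<Rightarrow>
     'a measure \<Rightarrow> ('a \<Rightarrow> real) \<Rightarrow> 'a \<Rightarrow> ereal" where
  "centered_maximal A G \<mu> f x =
     Sup {ereal (average \<mu> f (riemannian_ball A G x r)) | r. r > 0}"

definition noncentered_maximal ::
  "('a::topological_space, 'e::euclidean_space) chart set \<Rightarrow> ('a, 'e) metric_field \<Rightarrow>
     'a measure \<Rightarrow> ('a \<Rightarrow> real) \<Rightarrow> 'a \<Rightarrow> ereal" where
  "noncentered_maximal A G \<mu> f x =
     Sup {ereal (average \<mu> f (riemannian_ball A G z r)) | z r.
            r > 0 \<and> x \<in> riemannian_ball A G z r}"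

end

theory Submission
  imports Defs
begin

text \<open>Let \<open>B\<close> be a ball containing \<open>x\<close> and suppose that for some \<open>\<rho>\<close> both \<open>E = B - B(x,\<rho>)\<close> and
  \<open>F = B(x,\<rho>) - B\<close> have positive measure. With \<open>K = \<mu>(E)/\<mu>(F)\<close> the function
  \<open>f = 1\<^sub>E - K 1\<^sub>F\<close> has positive average over \<open>B\<close>, but nonpositive average over every ball
  \<open>B(x,r)\<close>, which misses \<open>E\<close> if \<open>r \<le> \<rho>\<close> and contains \<open>F\<close> otherwise. If \<open>B = B(a,s)\<close>, it
  suffices to find \<open>a\<close>, \<open>x\<close>, \<open>b\<close> in the support with \<open>d(x,b) < \<rho> < d(x,a)\<close> and
  \<open>d(a,x) = s < d(a,b)\<close>, and every nonconstant continuous curve contains such points. Of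
  Riemannian geometry this needs only that the distance separates points and is continuous
  for the manifold topology.\<close>

section \<open>Charts and piecewise smooth curves\<close>

context smooth_manifold
begin

lemma chart_cover:
  obtains c where "c \<in> A" "p \<in> fst c"
  using charts_cover by blast

lemma chart_inv_left: "c \<in> A \<Longrightarrow> p \<in> fst c \<Longrightarrow> chart_inv c (snd c p) = p"
  using chart_homeomorphism by (simp add: homeomorphism_def)

lemma chart_inv_right: "c \<in> A \<Longrightarrow> u \<in> chart_image c \<Longrightarrow> snd c (chart_inv c u) = u"
  using chart_homeomorphism by (simp add: homeomorphism_def)

lemma chart_inv_in_domain: "c \<in> A \<Longrightarrow> u \<in> chart_image c \<Longrightarrow> chart_inv c u \<in> fst c"
  using chart_homeomorphism unfolding homeomorphism_def by blast

lemma continuous_on_chart: "c \<in> A \<Longrightarrow> continuous_on (fst c) (snd c)"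
  using chart_homeomorphism by (simp add: homeomorphism_def)

lemma continuous_on_chart_inv: "c \<in> A \<Longrightarrow> continuous_on (chart_image c) (chart_inv c)"
  using chart_homeomorphism by (simp add: homeomorphism_def)

lemma transition_has_derivative:
  assumes "c \<in> A" "d \<in> A" "p \<in> fst c" "p \<in> fst d"
  shows "(transition c d has_derivative frechet_derivative (transition c d) (at (snd c p)))
    (at (snd c p))"
proof -
  have "Ck_on (Suc 0) (snd c ` (fst c \<inter> fst d)) (transition c d)"
    using smooth_transition[OF assms(1,2)] unfolding smooth_on_def by blast
  then show ?thesis
    using assms(3,4) by (auto simp: frechet_derivative_works[symmetric])
qed

lemma continuous_on_transition_derivative:
  assumes "c \<in> A" "d \<in> A"
  shows "continuous_on (snd c ` (fst c \<inter> fst d))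
    (\<lambda>u. frechet_derivative (transition c d) (at u) v)"
proof -
  have "Ck_on (Suc 0) (snd c ` (fst c \<inter> fst d)) (transition c d)"
    using smooth_transition[OF assms(1,2)] unfolding smooth_on_def by blast
  then show ?thesis by simp
qed

text \<open>The image is also the preimage of the ball under the coordinate map, which is continuous
  on an open domain. Such sets serve as coordinate neighbourhoods below.\<close>

lemma open_chart_ball:
  assumes c: "c \<in> A" and "ball u r \<subseteq> chart_image c"
  shows "open (chart_inv c ` ball u r)"
proof -
  have "chart_inv c ` ball u r = fst c \<inter> snd c -` ball u r"
  proof (intro set_eqI iffI)
    fix p assume "p \<in> chart_inv c ` ball u r"
    then show "p \<in> fst c \<inter> snd c -` ball u r"
      using assms(2) chart_inv_right[OF c] chart_inv_in_domain[OF c] by auto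
  next
    fix p assume "p \<in> fst c \<inter> snd c -` ball u r"
    then show "p \<in> chart_inv c ` ball u r"
      by (intro image_eqI[of _ _ "snd c p"]) (simp_all add: chart_inv_left[OF c])
  qed
  then show ?thesis
    using continuous_open_preimage[OF continuous_on_chart[OF c] open_domain[OF c] open_ball]
    by simp
qed

lemma C1_curve_cong:
  assumes "C1_curve A s t \<gamma>" "\<And>\<tau>. \<tau> \<in> {s..t} \<Longrightarrow> \<gamma> \<tau> = \<eta> \<tau>"
  shows "C1_curve A s t \<eta>"
  unfolding C1_curve_def
proof (intro conjI ballI)
  show "continuous_on {s..t} \<eta>"
    using assms unfolding C1_curve_def by (auto elim: continuous_on_eq)
next
  fix c assume "c \<in> A"
  then obtain V where V: "continuous_on ({s..t} \<inter> \<gamma> -` fst c) V"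
    "\<And>\<tau>. \<tau> \<in> {s..t} \<inter> \<gamma> -` fst c \<Longrightarrow>
      ((snd c \<circ> \<gamma>) has_vector_derivative V \<tau>) (at \<tau> within {s..t})"
    using assms(1) unfolding C1_curve_def by blast
  have eq: "{s..t} \<inter> \<eta> -` fst c = {s..t} \<inter> \<gamma> -` fst c"
    using assms(2) by auto
  have "((snd c \<circ> \<eta>) has_vector_derivative V \<tau>) (at \<tau> within {s..t})"
    if "\<tau> \<in> {s..t} \<inter> \<gamma> -` fst c" for \<tau>
    using that assms(2)
    by (intro has_vector_derivative_transform[OF _ _ V(2)[OF that]]) auto
  then show "\<exists>V. continuous_on ({s..t} \<inter> \<eta> -` fst c) V \<and>
      (\<forall>\<tau>\<in>{s..t} \<inter> \<eta> -` fst c. ((snd c \<circ> \<eta>) has_vector_derivative V \<tau>) (at \<tau> within {s..t}))"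
    unfolding eq using V(1) by blast
qed

text \<open>In any chart \<open>d\<close> the curve reads as \<open>transition c d\<close> after an
  affine line. The chain rule gives its velocity, which is continuous because the transition is
  C1.\<close>

lemma C1_curve_chart_line:
  assumes c: "c \<in> A" and line: "\<And>\<tau>. \<tau> \<in> {s..t} \<Longrightarrow> u + (\<tau> - b) *\<^sub>R w \<in> chart_image c"
  shows "C1_curve A s t (\<lambda>\<tau>. chart_inv c (u + (\<tau> - b) *\<^sub>R w))"
  unfolding C1_curve_def
proof (intro conjI ballI)
  define l where "l = (\<lambda>\<tau>. u + (\<tau> - b) *\<^sub>R w)"
  have l_cont: "continuous_on S l" for S
    unfolding l_def by (intro continuous_intros)
  have l_img: "l ` {s..t} \<subseteq> chart_image c"
    using line unfolding l_def by blast
  show "continuous_on {s..t} (\<lambda>\<tau>. chart_inv c (u + (\<tau> - b) *\<^sub>R w))"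
    using continuous_on_compose2[OF continuous_on_chart_inv[OF c] l_cont l_img]
    unfolding l_def .
  fix d assume d: "d \<in> A"
  define T where "T = {s..t} \<inter> (\<lambda>\<tau>. chart_inv c (l \<tau>)) -` fst d"
  define V where "V = (\<lambda>\<tau>. frechet_derivative (transition c d) (at (l \<tau>)) w)"
  have l_T: "l \<tau> \<in> snd c ` (fst c \<inter> fst d)" if "\<tau> \<in> T" for \<tau>
  proof
    have "l \<tau> \<in> chart_image c" using that l_img unfolding T_def by blast
    then show "l \<tau> = snd c (chart_inv c (l \<tau>))"
      and "chart_inv c (l \<tau>) \<in> fst c \<inter> fst d"
      using that chart_inv_right[OF c] chart_inv_in_domain[OF c] unfolding T_def by auto
  qed
  have "continuous_on T V"
    unfolding V_def
    by (rule continuous_on_compose2[OF continuous_on_transition_derivative[OF c d] l_cont])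
      (use l_T in blast)
  moreover have "((snd d \<circ> (\<lambda>\<tau>. chart_inv c (l \<tau>))) has_vector_derivative V \<tau>) (at \<tau> within {s..t})"
    if \<tau>: "\<tau> \<in> T" for \<tau>
  proof -
    obtain p where p: "p \<in> fst c" "p \<in> fst d" "l \<tau> = snd c p"
      using l_T[OF \<tau>] by blast
    have "(l has_vector_derivative w) (at \<tau> within {s..t})"
      unfolding l_def by (auto intro!: derivative_eq_intros)
    moreover have "(transition c d has_derivative frechet_derivative (transition c d) (at (l \<tau>)))
        (at (l \<tau>) within l ` {s..t})"
      using transition_has_derivative[OF c d p(1,2)] unfolding p(3)
      by (rule has_derivative_at_withinI)
    ultimately have "((transition c d \<circ> l) has_vector_derivative V \<tau>) (at \<tau> within {s..t})"
      unfolding V_def by (rule vector_derivative_diff_chain_within)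
    then show ?thesis
      by (simp add: transition_def o_def)
  qed
  ultimately show "\<exists>V. continuous_on ({s..t} \<inter> (\<lambda>\<tau>. chart_inv c (u + (\<tau> - b) *\<^sub>R w)) -` fst d) V \<and>
      (\<forall>\<tau>\<in>{s..t} \<inter> (\<lambda>\<tau>. chart_inv c (u + (\<tau> - b) *\<^sub>R w)) -` fst d.
        ((snd d \<circ> (\<lambda>\<tau>. chart_inv c (u + (\<tau> - b) *\<^sub>R w))) has_vector_derivative V \<tau>)
          (at \<tau> within {s..t}))"
    unfolding T_def l_def by (intro exI[of _ V] conjI ballI)
qed

end

section \<open>Speed and length of curves\<close>

context riemannian_manifold
begin

section \<open>The metric in a single chart\<close>

lemma metric_nonneg: "c \<in> A \<Longrightarrow> p \<in> fst c \<Longrightarrow> 0 \<le> G c p v v"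
  by (metis bilinear_lzero less_eq_real_def metric_bilinear metric_positive)

text \<open>Smoothness of the metric is given for fixed vectors. Expanding in the basis reduces
  joint continuity in point and vector to continuity of the coefficients.\<close>

lemma metric_expand:
  assumes "c \<in> A" "p \<in> fst c"
  shows "G c p v w = (\<Sum>(i, j)\<in>Basis \<times> Basis. (v \<bullet> i) * (w \<bullet> j) * G c p i j)"
proof -
  have bil: "bilinear (G c p)" using metric_bilinear assms .
  have "G c p v w = G c p (\<Sum>i\<in>Basis. (v \<bullet> i) *\<^sub>R i) (\<Sum>j\<in>Basis. (w \<bullet> j) *\<^sub>R j)"
    by (simp add: euclidean_representation)
  also have "\<dots> = (\<Sum>(i, j)\<in>Basis \<times> Basis. (v \<bullet> i) * (w \<bullet> j) * G c p i j)"
    unfolding bilinear_sum[OF bil]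
    by (intro sum.cong) (auto simp: bilinear_lmul[OF bil] bilinear_rmul[OF bil])
  finally show ?thesis .
qed

lemma continuous_on_metric:
  assumes c: "c \<in> A" and q: "continuous_on T q" "q ` T \<subseteq> chart_image c"
    and V: "continuous_on T V"
  shows "continuous_on T (\<lambda>t. G c (chart_inv c (q t)) (V t) (V t))"
proof -
  have comp: "continuous_on T (\<lambda>t. G c (chart_inv c (q t)) i j)" for i j
  proof -
    have "Ck_on 0 (chart_image c) (\<lambda>x. G c (chart_inv c x) i j)"
      using metric_smooth[OF c] unfolding smooth_on_def by blast
    then show ?thesis
      using continuous_on_compose2[OF _ q] by fastforce
  qed
  have "continuous_on T (\<lambda>t. \<Sum>(i, j)\<in>Basis \<times> Basis.
      (V t \<bullet> i) * (V t \<bullet> j) * G c (chart_inv c (q t)) i j)"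
    unfolding split_def by (intro continuous_intros V comp)
  then show ?thesis
    by (rule continuous_on_eq)
      (use q(2) chart_inv_in_domain[OF c] metric_expand[OF c] in \<open>auto simp: image_subset_iff\<close>)
qed

lemma metric_scaleR:
  assumes "c \<in> A" "p \<in> fst c"
  shows "G c p (k *\<^sub>R v) (k *\<^sub>R v) = k\<^sup>2 * G c p v v"
  using metric_bilinear[OF assms]
  by (simp add: bilinear_lmul bilinear_rmul power2_eq_square)

text \<open>The Riemannian norm is continuous and positive on the compact product of
  \<open>K\<close> with the unit sphere, so it has a positive minimum and a maximum there.
  Homogeneity carries both bounds to all vectors.\<close>

lemma metric_bounds:
  assumes c: "c \<in> A" and K: "compact K" "K \<subseteq> chart_image c" "K \<noteq> {}"
  obtains m C where "m > 0" "C > 0"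
    "\<And>u v. u \<in> K \<Longrightarrow> m * norm v \<le> sqrt (G c (chart_inv c u) v v)"
    "\<And>u v. u \<in> K \<Longrightarrow> sqrt (G c (chart_inv c u) v v) \<le> C * norm v"
proof -
  let ?S = "K \<times> sphere (0::'e) 1"
  define g where "g = (\<lambda>z. sqrt (G c (chart_inv c (fst z)) (snd z) (snd z)))"
  have comp: "compact ?S" using K(1) by (intro compact_Times) auto
  obtain e :: 'e where "norm e = 1" using vector_choose_size[of 1] by auto
  then have ne: "?S \<noteq> {}" using K(3) by (auto simp: dist_norm)
  have cont: "continuous_on ?S g"
    unfolding g_def
    by (intro continuous_intros continuous_on_metric[OF c]) (use K(2) in auto)
  obtain y where y: "y \<in> ?S" "\<And>z. z \<in> ?S \<Longrightarrow> g y \<le> g z"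
    using continuous_attains_inf[OF comp ne cont] by blast
  obtain x where x: "x \<in> ?S" "\<And>z. z \<in> ?S \<Longrightarrow> g z \<le> g x"
    using continuous_attains_sup[OF comp ne cont] by blast
  have "g y > 0"
    using y(1) K(2) unfolding g_def
    by (auto intro!: metric_positive[OF c] chart_inv_in_domain[OF c])
  moreover have "g x > 0" using \<open>g y > 0\<close> x(2)[OF y(1)] by linarith
  \<comment> \<open>For \<open>v = 0\<close> the normalized vector is not a unit vector, but both
    sides vanish.\<close>
  moreover have scal: "sqrt (G c (chart_inv c u) v v) = norm v * g (u, v /\<^sub>R norm v)"
    if "u \<in> K" for u v
  proof (cases "v = 0")
    case True
    have "bilinear (G c (chart_inv c u))"
      using that K(2) metric_bilinear[OF c] chart_inv_in_domain[OF c] by blast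
    with True show ?thesis by (simp add: bilinear_lzero)
  next
    case False
    have "u \<in> chart_image c" using that K(2) by blast
    then have "G c (chart_inv c u) v v
        = (norm v)\<^sup>2 * G c (chart_inv c u) (v /\<^sub>R norm v) (v /\<^sub>R norm v)"
      using metric_scaleR[OF c chart_inv_in_domain[OF c], of u "norm v" "v /\<^sub>R norm v"] False
      by simp
    then show ?thesis
      by (simp add: g_def real_sqrt_mult)
  qed
  moreover have "g y * norm v \<le> norm v * g (u, v /\<^sub>R norm v)"
    and "norm v * g (u, v /\<^sub>R norm v) \<le> g x * norm v" if "u \<in> K" for u v
  proof -
    have "v = 0 \<or> (u, v /\<^sub>R norm v) \<in> ?S" using that by (cases "v = 0") (simp_all add: dist_norm)
    then show "g y * norm v \<le> norm v * g (u, v /\<^sub>R norm v)"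
      "norm v * g (u, v /\<^sub>R norm v) \<le> g x * norm v"
      using x(2) y(2) by (auto simp: mult.commute mult_left_mono)
  qed
  ultimately show thesis using that[of "g y" "g x"] by simp
qed

section \<open>Speed does not depend on the chart\<close>

lemma speed_nonneg: "0 \<le> speed A G \<gamma> t"
proof -
  obtain d where "d \<in> A \<and> \<gamma> t \<in> fst d" using chart_cover by blast
  then have "(SOME c. c \<in> A \<and> \<gamma> t \<in> fst c) \<in> A \<and> \<gamma> t \<in> fst (SOME c. c \<in> A \<and> \<gamma> t \<in> fst c)"
    by (rule someI)
  then show ?thesis
    unfolding speed_def Let_def by (intro real_sqrt_ge_zero metric_nonneg) auto
qed

text \<open>\<open>speed\<close> picks an arbitrary chart \<open>d\<close> around the point. Passing
  from \<open>c\<close> to \<open>d\<close> applies the derivative of the transition to the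
  velocity, and \<open>metric_transform\<close> says that this preserves the metric. Continuity
  keeps the curve in the domain of \<open>c\<close> near \<open>t\<close>, where both coordinate
  expressions can be compared.\<close>

lemma speed_eq:
  assumes c: "c \<in> A" "\<gamma> t \<in> fst c" and cont: "isCont \<gamma> t"
    and v: "((snd c \<circ> \<gamma>) has_vector_derivative v) (at t)"
  shows "speed A G \<gamma> t = sqrt (G c (\<gamma> t) v v)"
proof -
  define d where "d = (SOME c. c \<in> A \<and> \<gamma> t \<in> fst c)"
  have d: "d \<in> A" "\<gamma> t \<in> fst d"
    using someI[of "\<lambda>c. c \<in> A \<and> \<gamma> t \<in> fst c" c] c unfolding d_def by auto
  define F where "F = frechet_derivative (transition c d) (at (snd c (\<gamma> t)))"
  have "(transition c d has_derivative F) (at ((snd c \<circ> \<gamma>) t) within range (snd c \<circ> \<gamma>))"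
    using transition_has_derivative[OF c(1) d(1) c(2) d(2)] unfolding F_def o_def
    by (rule has_derivative_at_withinI)
  then have "((transition c d \<circ> (snd c \<circ> \<gamma>)) has_vector_derivative F v) (at t)"
    by (rule vector_derivative_diff_chain_within[OF v])
  moreover have "\<forall>\<^sub>F \<tau> in at t. (transition c d \<circ> (snd c \<circ> \<gamma>)) \<tau> = (snd d \<circ> \<gamma>) \<tau>"
    using topological_tendstoD[OF cont[unfolded isCont_def] open_domain[OF c(1)] c(2)]
    by eventually_elim (simp add: transition_def chart_inv_left[OF c(1)])
  ultimately have "((snd d \<circ> \<gamma>) has_vector_derivative F v) (at t)"
    unfolding has_vector_derivative_def
    by (rule has_derivative_transform_eventually)
      (use c in \<open>simp_all add: transition_def chart_inv_left\<close>)
  then have "vector_derivative (snd d \<circ> \<gamma>) (at t) = F v"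
    by (rule vector_derivative_at)
  then show ?thesis
    unfolding speed_def Let_def d_def[symmetric] F_def
    by (simp add: metric_transform[OF c(1) d(1) c(2) d(2)])
qed


text \<open>The formula is confined to the open interval: \<open>speed\<close> is built on the
  two-sided derivative, whereas at the end points \<open>V\<close> is only a one-sided one.\<close>

lemma C1_curve_speed:
  assumes C1: "C1_curve A s t \<gamma>" and c: "c \<in> A" "\<gamma> ` {s..t} \<subseteq> fst c"
  obtains V where "continuous_on {s..t} V"
    "\<And>\<tau>. \<tau> \<in> {s<..<t} \<Longrightarrow> ((snd c \<circ> \<gamma>) has_vector_derivative V \<tau>) (at \<tau>)"
    "\<And>\<tau>. \<tau> \<in> {s<..<t} \<Longrightarrow> speed A G \<gamma> \<tau> = sqrt (G c (\<gamma> \<tau>) (V \<tau>) (V \<tau>))"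
proof -
  have "{s..t} \<inter> \<gamma> -` fst c = {s..t}" using c(2) by auto
  then obtain V where V: "continuous_on {s..t} V"
    "\<And>\<tau>. \<tau> \<in> {s..t} \<Longrightarrow> ((snd c \<circ> \<gamma>) has_vector_derivative V \<tau>) (at \<tau> within {s..t})"
    using C1 c(1) unfolding C1_curve_def by metis
  have deriv: "((snd c \<circ> \<gamma>) has_vector_derivative V \<tau>) (at \<tau>)" if "\<tau> \<in> {s<..<t}" for \<tau>
    using V(2)[of \<tau>] that by (simp add: at_within_Icc_at)
  have "isCont \<gamma> \<tau>" if "\<tau> \<in> {s<..<t}" for \<tau>
    using C1 that continuous_on_interior[of "{s..t}" \<gamma> \<tau>] unfolding C1_curve_def by simp
  then have "speed A G \<gamma> \<tau> = sqrt (G c (\<gamma> \<tau>) (V \<tau>) (V \<tau>))" if "\<tau> \<in> {s<..<t}" for \<tau>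
    using c that deriv by (intro speed_eq) auto
  then show thesis using that V(1) deriv by blast
qed

text \<open>Off the two end points the speed agrees with a function that is continuous on the closed
  interval.\<close>

lemma C1_curve_speed_integrable:
  assumes C1: "C1_curve A s t \<gamma>" and c: "c \<in> A" "\<gamma> ` {s..t} \<subseteq> fst c"
  shows "speed A G \<gamma> integrable_on {s..t}"
proof -
  obtain V where V: "continuous_on {s..t} V"
    "\<And>\<tau>. \<tau> \<in> {s<..<t} \<Longrightarrow> speed A G \<gamma> \<tau> = sqrt (G c (\<gamma> \<tau>) (V \<tau>) (V \<tau>))"
    using C1_curve_speed[OF C1 c] by metis
  have "continuous_on {s..t} (\<lambda>\<tau>. snd c (\<gamma> \<tau>))"
    using C1 c(2) unfolding C1_curve_def
    by (intro continuous_on_compose2[OF continuous_on_chart[OF c(1)]]) auto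
  then have "continuous_on {s..t} (\<lambda>\<tau>. G c (chart_inv c (snd c (\<gamma> \<tau>))) (V \<tau>) (V \<tau>))"
    using c(2) V(1) by (intro continuous_on_metric[OF c(1)]) (auto simp: chart_image_def)
  then have "(\<lambda>\<tau>. sqrt (G c (chart_inv c (snd c (\<gamma> \<tau>))) (V \<tau>) (V \<tau>))) integrable_on {s..t}"
    by (intro integrable_continuous_interval continuous_intros)
  then show ?thesis
    by (rule integrable_spike_finite[of "{s, t}", rotated 2])
      (use c V(2) chart_inv_left[OF c(1)] in \<open>auto simp: image_subset_iff\<close>)
qed

section \<open>Integrability of the speed and a lower bound for the length\<close>

lemma piecewise_C1_curve_subinterval:
  assumes "piecewise_C1_curve A a b \<gamma>" "a \<le> s" "t \<le> b"
  shows "piecewise_C1_curve A s t \<gamma>"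
proof -
  obtain P where P: "finite P"
    "\<And>s t. a \<le> s \<Longrightarrow> s < t \<Longrightarrow> t \<le> b \<Longrightarrow> {s<..<t} \<inter> P = {} \<Longrightarrow> C1_curve A s t \<gamma>"
    using assms(1) unfolding piecewise_C1_curve_def by blast
  moreover have "continuous_on {s..t} \<gamma>"
    using assms unfolding piecewise_C1_curve_def
    by (auto elim: continuous_on_subset)
  ultimately show ?thesis
    unfolding piecewise_C1_curve_def using assms(2,3) by (intro conjI exI[of _ P]) auto
qed

text \<open>With a chart domain for \<open>U\<close> and the break points for \<open>P\<close>, this
  localizes a curve to one chart with \<open>x\<close> as the only possible break.\<close>

lemma continuous_curve_local:
  fixes \<gamma> :: "real \<Rightarrow> 'a"
  assumes "continuous_on {a..b} \<gamma>" "x \<in> {a..b}" "finite P" "open U" "\<gamma> x \<in> U"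
  obtains d where "d > 0" "\<gamma> ` ({a..b} \<inter> ball x d) \<subseteq> U" "P \<inter> ball x d \<subseteq> {x}"
proof -
  obtain S where S: "open S" "x \<in> S" "\<gamma> ` ({a..b} \<inter> S) \<subseteq> U"
    using assms(1,2,4,5) unfolding continuous_on_topological by (metis IntE image_subsetI)
  have "open (S - (P - {x}))"
    using S(1) assms(3) by (intro open_Diff finite_imp_closed) auto
  then obtain d where "d > 0" "ball x d \<subseteq> S - (P - {x})"
    using S(2) by (metis Diff_iff openE singletonI)
  then show thesis using that[of d] S(3) by blast
qed

text \<open>Integrability over a compact interval is a local matter. A small interval around
  \<open>x\<close> is cut at \<open>x\<close>; each half lies in one chart and has no break point in
  its interior, so the curve is C1 on it.\<close>

lemma speed_integrable:
  assumes "piecewise_C1_curve A a b \<gamma>"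
  shows "speed A G \<gamma> integrable_on {a..b}"
proof -
  obtain P where P: "finite P"
    "\<And>s t. a \<le> s \<Longrightarrow> s < t \<Longrightarrow> t \<le> b \<Longrightarrow> {s<..<t} \<inter> P = {} \<Longrightarrow> C1_curve A s t \<gamma>"
    and cont: "continuous_on {a..b} \<gamma>"
    using assms unfolding piecewise_C1_curve_def by blast
  have "\<exists>d>0. \<forall>u v. x \<in> {u..v} \<and> {u..v} \<subseteq> ball x d \<and> {u..v} \<subseteq> {a..b} \<longrightarrow>
      speed A G \<gamma> integrable_on {u..v}" if x: "x \<in> {a..b}" for x
  proof -
    obtain c where c: "c \<in> A" "\<gamma> x \<in> fst c" using chart_cover .
    obtain d where d: "d > 0" "\<gamma> ` ({a..b} \<inter> ball x d) \<subseteq> fst c" "P \<inter> ball x d \<subseteq> {x}"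
      using continuous_curve_local[OF cont x P(1) open_domain[OF c(1)] c(2)] .
    have piece: "speed A G \<gamma> integrable_on {s..t}"
      if "{s..t} \<subseteq> ball x d" "{s..t} \<subseteq> {a..b}" "s = x \<or> t = x" for s t
    proof (cases "s < t")
      case True
      have "{s<..<t} \<inter> P \<subseteq> {x} \<inter> {s<..<t}"
        using d(3) that(1) greaterThanLessThan_subseteq_atLeastAtMost_iff[of s t s t] by blast
      then have "{s<..<t} \<inter> P = {}" using that(3) by auto
      then have "C1_curve A s t \<gamma>" using P(2) that(2) True by auto
      moreover have "\<gamma> ` {s..t} \<subseteq> fst c" using d(2) that(1,2) by blast
      ultimately show ?thesis using C1_curve_speed_integrable c(1) by blast
    next
      case False
      then show ?thesis using integrable_on_refl[of _ t] by (cases "s = t") auto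
    qed
    have "speed A G \<gamma> integrable_on {u..v}"
      if uv: "x \<in> {u..v}" "{u..v} \<subseteq> ball x d" "{u..v} \<subseteq> {a..b}" for u v
    proof (rule Henstock_Kurzweil_Integration.integrable_combine)
      have "{u..x} \<subseteq> {u..v}" "{x..v} \<subseteq> {u..v}" using uv(1) by auto
      then show "speed A G \<gamma> integrable_on {u..x}" "speed A G \<gamma> integrable_on {x..v}"
        using uv(2,3) by (intro piece; blast)+
    qed (use uv(1) in auto)
    then show ?thesis using d(1) by blast
  qed
  then show ?thesis
    using integrable_on_little_subintervals[of a b "speed A G \<gamma>"] by simp
qed

lemma curve_length_nonneg: "0 \<le> curve_length A G a b \<gamma>"
  unfolding curve_length_def
  \<comment> \<open>A non-integrable function has \<open>integral\<close> 0 by convention.\<close>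
  by (cases "speed A G \<gamma> integrable_on {a..b}")
    (simp_all add: integral_nonneg speed_nonneg not_integrable_integral)

text \<open>The coordinate velocity has norm at most speed divided by \<open>m\<close>, and its
  integral is the coordinate displacement by the fundamental theorem of calculus with finitely many
  exceptional points.\<close>

lemma curve_length_ge_coordinate_distance:
  assumes pw: "piecewise_C1_curve A a b \<gamma>" and ab: "a \<le> b"
    and c: "c \<in> A" "\<gamma> ` {a..b} \<subseteq> fst c"
    and m: "\<And>\<tau> v. \<tau> \<in> {a..b} \<Longrightarrow> m * norm v \<le> sqrt (G c (\<gamma> \<tau>) v v)"
    and m0: "0 < m"
  shows "m * norm (snd c (\<gamma> b) - snd c (\<gamma> a)) \<le> curve_length A G a b \<gamma>"
proof -
  obtain P where P: "finite P"
    "\<And>s t. a \<le> s \<Longrightarrow> s < t \<Longrightarrow> t \<le> b \<Longrightarrow> {s<..<t} \<inter> P = {} \<Longrightarrow> C1_curve A s t \<gamma>"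
    and cont: "continuous_on {a..b} \<gamma>"
    using pw unfolding piecewise_C1_curve_def by blast
  have ex: "\<exists>v. ((snd c \<circ> \<gamma>) has_vector_derivative v) (at \<tau>) \<and>
      speed A G \<gamma> \<tau> = sqrt (G c (\<gamma> \<tau>) v v)" if \<tau>: "\<tau> \<in> {a<..<b} - P" for \<tau>
  proof -
    have "open ({a<..<b} - P)"
      using P(1) by (intro open_Diff finite_imp_closed) auto
    then obtain e where e: "e > 0" "cball \<tau> e \<subseteq> {a<..<b} - P"
      using \<tau> open_contains_cball by meson
    have sub: "{\<tau> - e..\<tau> + e} \<subseteq> {a<..<b} - P"
      using e(2) unfolding cball_eq_atLeastAtMost .
    moreover have "{\<tau> - e<..<\<tau> + e} \<subseteq> {\<tau> - e..\<tau> + e}" "\<tau> - e \<in> {\<tau> - e..\<tau> + e}"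
      "\<tau> + e \<in> {\<tau> - e..\<tau> + e}"
      using e(1) by auto
    ultimately have "\<tau> - e \<in> {a<..<b}" "\<tau> + e \<in> {a<..<b}" "{\<tau> - e<..<\<tau> + e} \<inter> P = {}"
      by blast+
    then have "C1_curve A (\<tau> - e) (\<tau> + e) \<gamma>" using P(2) e(1) by auto
    moreover have "\<gamma> ` {\<tau> - e..\<tau> + e} \<subseteq> fst c"
      using c(2) sub greaterThanLessThan_subseteq_atLeastAtMost_iff[of a b a b] by blast
    ultimately obtain V where "((snd c \<circ> \<gamma>) has_vector_derivative V \<tau>) (at \<tau>)"
      "speed A G \<gamma> \<tau> = sqrt (G c (\<gamma> \<tau>) (V \<tau>) (V \<tau>))"
      using C1_curve_speed[OF _ c(1)] e(1)
      by (metis greaterThanLessThan_iff less_add_same_cancel1 diff_less_eq)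
    then show ?thesis by blast
  qed
  then obtain V where V: "\<And>\<tau>. \<tau> \<in> {a<..<b} - P \<Longrightarrow>
      ((snd c \<circ> \<gamma>) has_vector_derivative V \<tau>) (at \<tau>) \<and>
      speed A G \<gamma> \<tau> = sqrt (G c (\<gamma> \<tau>) (V \<tau>) (V \<tau>))"
    by metis
  \<comment> \<open>The value 0 at break points and end points keeps the bound by the speed valid on
    the whole closed interval.\<close>
  define W where "W = (\<lambda>\<tau>. if \<tau> \<in> {a<..<b} - P then V \<tau> else 0)"
  have "continuous_on {a..b} (snd c \<circ> \<gamma>)"
    using continuous_on_compose[OF cont continuous_on_subset[OF continuous_on_chart[OF c(1)] c(2)]] .
  then have W: "(W has_integral (snd c \<circ> \<gamma>) b - (snd c \<circ> \<gamma>) a) {a..b}"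
  proof (rule fundamental_theorem_of_calculus_interior_strong[OF P(1) ab, rotated])
    show "((snd c \<circ> \<gamma>) has_vector_derivative W \<tau>) (at \<tau>)" if "\<tau> \<in> {a<..<b} - P" for \<tau>
      using V[OF that] that unfolding W_def by (simp only: if_True)
  qed
  have "norm (W \<tau>) \<le> speed A G \<gamma> \<tau> / m" if "\<tau> \<in> {a..b}" for \<tau>
    using V[of \<tau>] m[OF that, of "V \<tau>"] m0 speed_nonneg[of \<gamma> \<tau>]
    unfolding W_def by (auto simp: field_simps)
  then have "norm (integral {a..b} W) \<le> integral {a..b} (\<lambda>\<tau>. speed A G \<gamma> \<tau> / m)"
    using W integrable_on_divide[OF speed_integrable[OF pw]]
    by (intro Henstock_Kurzweil_Integration.integral_norm_bound_integral)
      (auto simp: has_integral_integrable)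
  then show ?thesis
    using integral_unique[OF W] m0 unfolding curve_length_def
    by (simp add: field_simps)
qed

section \<open>The Riemannian distance\<close>

lemma riemannian_dist_self: "riemannian_dist A G x x = 0"
proof -
  have "piecewise_C1_curve A 0 0 (\<lambda>_. x)"
    unfolding piecewise_C1_curve_def by auto
  moreover have "curve_length A G 0 0 (\<lambda>_. x) = 0"
    unfolding curve_length_def by simp
  ultimately have "riemannian_dist A G x x \<le> ennreal 0"
    unfolding riemannian_dist_def
    by (intro Inf_lower CollectI exI[of _ 0] exI[of _ "\<lambda>_. x"]) simp
  then show ?thesis by simp
qed

text \<open>A small coordinate ball around \<open>x\<close> omits \<open>y\<close>, and on its
  closure the metric dominates \<open>m\<close> times the Euclidean norm. Every curve from
  \<open>x\<close> to \<open>y\<close> must leave the ball, so it covers coordinate distance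
  \<open>r\<close> and has length at least \<open>m * r\<close>.\<close>

lemma riemannian_dist_pos:
  assumes "x \<noteq> y"
  shows "0 < riemannian_dist A G x y"
proof -
  obtain c where c: "c \<in> A" "x \<in> fst c" using chart_cover .
  define p where "p = snd c x"
  have p: "p \<in> chart_image c" "chart_inv c p = x"
    using c chart_inv_left unfolding p_def chart_image_def by auto
  obtain e where e: "e > 0" "cball p e \<subseteq> chart_image c"
    using open_image[OF c(1)] p(1) open_contains_cball by meson
  \<comment> \<open>If \<open>y\<close> lies in the chart, the radius is limited by its coordinate
    distance from \<open>p\<close>; otherwise every ball inside the chart omits
    \<open>y\<close>.\<close>
  obtain r where r: "r > 0" "r \<le> e" "y \<notin> chart_inv c ` ball p r"
  proof (cases "y \<in> fst c")
    case True
    then have "0 < dist p (snd c y)"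
      using assms c p chart_inv_left by fastforce
    moreover have "y \<notin> chart_inv c ` ball p (min e (dist p (snd c y)))"
    proof
      assume "y \<in> chart_inv c ` ball p (min e (dist p (snd c y)))"
      then obtain q where q: "y = chart_inv c q" "dist p q < e" "dist p q < dist p (snd c y)"
        by auto
      then have "q \<in> chart_image c" using e(2) by auto
      then show False using q chart_inv_right[OF c(1)] by auto
    qed
    ultimately show thesis using that[of "min e (dist p (snd c y))"] e(1) by auto
  next
    case False
    have "ball p e \<subseteq> chart_image c" using e(2) ball_subset_cball by blast
    then have "y \<notin> chart_inv c ` ball p e"
      using False chart_inv_in_domain[OF c(1)] by auto
    then show thesis using that[of e] e(1) by simp
  qed
  have sub: "cball p r \<subseteq> chart_image c" using e(2) r(2) by (meson order_trans subset_cball)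
  then have ball_sub: "ball p r \<subseteq> chart_image c" using ball_subset_cball by blast
  obtain m where m: "m > 0"
    "\<And>u v. u \<in> cball p r \<Longrightarrow> m * norm v \<le> sqrt (G c (chart_inv c u) v v)"
    using metric_bounds[OF c(1) compact_cball sub] r(1) by (metis cball_eq_empty not_less_iff_gr_or_eq)
  have "m * r \<le> curve_length A G a b \<gamma>"
    if ab: "a \<le> b" and pw: "piecewise_C1_curve A a b \<gamma>" and ends: "\<gamma> a = x" "\<gamma> b = y" for a b \<gamma>
  proof -
    have cont: "continuous_on {a..b} \<gamma>" using pw unfolding piecewise_C1_curve_def by blast
    define U where "U = chart_inv c ` ball p r"
    \<comment> \<open>\<open>E\<close> collects the times spent outside the ball; its minimum
      \<open>\<tau>\<close> is the first exit time.\<close>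
    define E where "E = {a..b} \<inter> \<gamma> -` (- U)"
    have "open U" unfolding U_def by (rule open_chart_ball[OF c(1) ball_sub])
    then have "closed E" unfolding E_def
      by (intro continuous_closed_preimage[OF cont]) auto
    moreover have "bounded E"
      unfolding E_def by (rule bounded_subset[OF bounded_closed_interval]) auto
    ultimately have "compact E" by (simp add: compact_eq_bounded_closed)
    moreover have "b \<in> E" using ab ends(2) r(3) unfolding E_def U_def by auto
    ultimately obtain \<tau> where \<tau>: "\<tau> \<in> E" "\<And>t. t \<in> E \<Longrightarrow> \<tau> \<le> t"
      using compact_attains_inf[of E] by blast
    have "x \<in> U" unfolding U_def using p(2) r(1) by force
    then have "a < \<tau>" using \<tau>(1) ends(1) unfolding E_def by (cases "\<tau> = a") auto
    have before: "\<gamma> t \<in> U" if "t \<in> {a..<\<tau>}" for t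
      using that \<tau> unfolding E_def by force
    \<comment> \<open>In a Hausdorff space the compact image of the closed ball is closed, so the
      exit point still belongs to it. As it is outside the open ball, its coordinates are at
      distance at least \<open>r\<close> from \<open>p\<close>.\<close>
    have "compact (chart_inv c ` cball p r)"
      using continuous_on_subset[OF continuous_on_chart_inv[OF c(1)] sub]
      by (intro compact_continuous_image) auto
    then have "closed (chart_inv c ` cball p r)" by (rule compact_imp_closed)
    moreover have "continuous_on (closure {a..<\<tau>}) \<gamma>"
      using cont \<tau>(1) \<open>a < \<tau>\<close> unfolding E_def by (auto elim: continuous_on_subset)
    ultimately have "\<gamma> ` closure {a..<\<tau>} \<subseteq> chart_inv c ` cball p r"
      using before unfolding U_def by (intro image_closure_subset) (use ball_subset_cball in blast)+
    then have img: "\<gamma> ` {a..\<tau>} \<subseteq> chart_inv c ` cball p r" using \<open>a < \<tau>\<close> by simp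
    have "r \<le> norm (snd c (\<gamma> \<tau>) - snd c (\<gamma> a))"
    proof -
      obtain q where q: "q \<in> cball p r" "\<gamma> \<tau> = chart_inv c q"
        using img \<open>a < \<tau>\<close> by (force simp: image_subset_iff)
      then have "q \<notin> ball p r" using \<tau>(1) unfolding E_def U_def by auto
      then have "r \<le> dist p q" by simp
      moreover have "snd c (\<gamma> \<tau>) = q" using q sub chart_inv_right[OF c(1)] by auto
      ultimately show ?thesis using ends(1) by (simp add: p_def dist_norm norm_minus_commute)
    qed
    then have "m * r \<le> m * norm (snd c (\<gamma> \<tau>) - snd c (\<gamma> a))" using m(1) by simp
    also have "\<dots> \<le> curve_length A G a \<tau> \<gamma>"
    proof (rule curve_length_ge_coordinate_distance[OF _ _ c(1) _ _ m(1)])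
      show "piecewise_C1_curve A a \<tau> \<gamma>"
        using piecewise_C1_curve_subinterval[OF pw] \<tau>(1) unfolding E_def by auto
      show "\<gamma> ` {a..\<tau>} \<subseteq> fst c"
        by (rule order_trans[OF img]) (use sub chart_inv_in_domain[OF c(1)] in \<open>auto simp: subset_iff\<close>)
      show "m * norm v \<le> sqrt (G c (\<gamma> t) v v)" if "t \<in> {a..\<tau>}" for t v
      proof -
        obtain q where "q \<in> cball p r" "\<gamma> t = chart_inv c q" using \<open>t \<in> {a..\<tau>}\<close> img by blast
        then show ?thesis using m(2) by simp
      qed
    qed (use \<open>a < \<tau>\<close> in simp)
    also have "\<dots> \<le> curve_length A G a b \<gamma>"
      unfolding curve_length_def
    proof (rule integral_subset_le)
      show "{a..\<tau>} \<subseteq> {a..b}" using \<tau>(1) unfolding E_def by auto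
      show "speed A G \<gamma> integrable_on {a..\<tau>}" "speed A G \<gamma> integrable_on {a..b}"
        using speed_integrable piecewise_C1_curve_subinterval[OF pw] \<tau>(1) pw unfolding E_def by auto
    qed (simp add: speed_nonneg)
    finally show ?thesis .
  qed
  then have "ennreal (m * r) \<le> riemannian_dist A G x y"
    unfolding riemannian_dist_def by (intro Inf_greatest) (auto intro!: ennreal_leI)
  moreover have "0 < ennreal (m * r)" using m(1) r(1) by simp
  ultimately show ?thesis by order
qed


section \<open>Continuity of the distance in the manifold topology\<close>

text \<open>The possible corner at \<open>b\<close> becomes one more break point, so only the
  positions have to match there, not the velocities.\<close>

lemma piecewise_C1_curve_append_line:
  assumes pw: "piecewise_C1_curve A a b \<gamma>" and ab: "a \<le> b"
    and c: "c \<in> A" "chart_inv c u = \<gamma> b"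
    and line: "\<And>\<tau>. \<tau> \<in> {b..b + 1} \<Longrightarrow> u + (\<tau> - b) *\<^sub>R w \<in> chart_image c"
  shows "piecewise_C1_curve A a (b + 1)
    (\<lambda>\<tau>. if \<tau> \<le> b then \<gamma> \<tau> else chart_inv c (u + (\<tau> - b) *\<^sub>R w))"
    (is "piecewise_C1_curve A a _ ?\<eta>")
proof -
  obtain P where P: "finite P"
    "\<And>s t. a \<le> s \<Longrightarrow> s < t \<Longrightarrow> t \<le> b \<Longrightarrow> {s<..<t} \<inter> P = {} \<Longrightarrow> C1_curve A s t \<gamma>"
    and cont: "continuous_on {a..b} \<gamma>"
    using pw unfolding piecewise_C1_curve_def by blast
  have line_C1: "C1_curve A s t ?\<eta>" if "b \<le> s" "t \<le> b + 1" for s t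
  proof (rule C1_curve_cong)
    show "C1_curve A s t (\<lambda>\<tau>. chart_inv c (u + (\<tau> - b) *\<^sub>R w))"
      using that by (intro C1_curve_chart_line[OF c(1)] line) auto
    show "chart_inv c (u + (\<tau> - b) *\<^sub>R w) = ?\<eta> \<tau>" if "\<tau> \<in> {s..t}" for \<tau>
      using that \<open>b \<le> s\<close> c(2) by (cases "\<tau> = b") auto
  qed
  have "continuous_on ({a..b} \<union> {b..b + 1}) ?\<eta>"
  proof (rule continuous_on_closed_Un)
    show "continuous_on {a..b} ?\<eta>" using cont by (rule continuous_on_eq) simp
    show "continuous_on {b..b + 1} ?\<eta>" using line_C1[of b "b + 1"] unfolding C1_curve_def by simp
  qed auto
  moreover have "{a..b} \<union> {b..b + 1} = {a..b + 1}" using ab by auto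
  moreover have "C1_curve A s t ?\<eta>"
    if st: "a \<le> s" "s < t" "t \<le> b + 1" "{s<..<t} \<inter> insert b P = {}" for s t
  proof (cases "t \<le> b")
    case True
    have "C1_curve A s t \<gamma>" using P(2) st True by auto
    then show ?thesis by (rule C1_curve_cong) (use True in auto)
  next
    case False
    then have "b \<le> s" using st by auto
    then show ?thesis using line_C1 st by blast
  qed
  ultimately show ?thesis
    unfolding piecewise_C1_curve_def using P(1)
    by (intro conjI exI[of _ "insert b P"] allI impI) (simp_all only: finite_insert)
qed

text \<open>The segment is run through in unit time, so a bound \<open>L\<close> on its speed bounds
  the added length.\<close>

lemma curve_length_append_line:
  assumes pw: "piecewise_C1_curve A a b \<gamma>" and ab: "a \<le> b"
    and c: "c \<in> A" "chart_inv c u = \<gamma> b"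
    and line: "\<And>\<tau>. \<tau> \<in> {b..b + 1} \<Longrightarrow> u + (\<tau> - b) *\<^sub>R w \<in> chart_image c"
    and L: "\<And>\<tau>. \<tau> \<in> {b..b + 1} \<Longrightarrow>
      sqrt (G c (chart_inv c (u + (\<tau> - b) *\<^sub>R w)) w w) \<le> L"
  shows "curve_length A G a (b + 1)
      (\<lambda>\<tau>. if \<tau> \<le> b then \<gamma> \<tau> else chart_inv c (u + (\<tau> - b) *\<^sub>R w))
    \<le> curve_length A G a b \<gamma> + L"
    (is "curve_length A G a _ ?\<eta> \<le> _")
proof -
  have pw': "piecewise_C1_curve A a (b + 1) ?\<eta>"
    by (rule piecewise_C1_curve_append_line[OF pw ab c line])
  have cont: "isCont ?\<eta> \<tau>" if "\<tau> \<in> {a<..<b + 1}" for \<tau>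
    using pw' that continuous_on_interior[of "{a..b + 1}" ?\<eta> \<tau>]
    unfolding piecewise_C1_curve_def by simp
  have int: "speed A G ?\<eta> integrable_on {a..b + 1}"
    by (rule speed_integrable[OF pw'])
  \<comment> \<open>Speed depends only on the curve near the given time. At \<open>b\<close> itself
    the new curve may have another derivative, but a single point does not affect the
    integral.\<close>
  have "speed A G ?\<eta> \<tau> = speed A G \<gamma> \<tau>" if "\<tau> \<in> {a..b} - {b}" for \<tau>
  proof -
    have "\<tau> < b" using that by auto
    then have "\<forall>\<^sub>F t in nhds \<tau>. t < b"
      using eventually_nhds_in_open[of "{..<b}" \<tau>] by simp
    then have vd: "vector_derivative (snd d \<circ> ?\<eta>) (at \<tau>) = vector_derivative (snd d \<circ> \<gamma>) (at \<tau>)" for d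
      by (intro vector_derivative_cong_eq) (auto elim: eventually_mono)
    have "?\<eta> \<tau> = \<gamma> \<tau>" using \<open>\<tau> < b\<close> by simp
    then show ?thesis by (simp only: speed_def Let_def vd)
  qed
  then have first: "integral {a..b} (speed A G ?\<eta>) = integral {a..b} (speed A G \<gamma>)"
    by (intro integral_spike[of "{b}"]) auto
  have bound: "speed A G ?\<eta> \<tau> \<le> L" if \<tau>: "\<tau> \<in> {b<..<b + 1}" for \<tau>
  proof -
    define l where "l = (\<lambda>t. u + (t - b) *\<^sub>R w)"
    have img: "l t \<in> chart_image c" if "t \<in> {b<..<b + 1}" for t
      using that line unfolding l_def by auto
    have "(l has_vector_derivative w) (at \<tau>)"
      unfolding l_def by (auto intro!: derivative_eq_intros)
    then have "((snd c \<circ> ?\<eta>) has_vector_derivative w) (at \<tau>)"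
      by (rule has_vector_derivative_transform_within_open[of _ _ _ "{b<..<b + 1}"])
        (use \<tau> img chart_inv_right[OF c(1)] in \<open>auto simp: l_def\<close>)
    moreover have "?\<eta> \<tau> \<in> fst c"
      using \<tau> chart_inv_in_domain[OF c(1) img[OF \<tau>]] unfolding l_def by simp
    ultimately have "speed A G ?\<eta> \<tau> = sqrt (G c (?\<eta> \<tau>) w w)"
      using cont[of \<tau>] \<tau> ab by (intro speed_eq[OF c(1)]) auto
    then show ?thesis using L[of \<tau>] \<tau> by simp
  qed
  \<comment> \<open>The bound \<open>L\<close> is known only inside the interval, so the speed is
    replaced by \<open>L\<close> at both ends.\<close>
  have "integral {b..b + 1} (speed A G ?\<eta>)
      = integral {b..b + 1} (\<lambda>\<tau>. if \<tau> \<in> {b, b + 1} then L else speed A G ?\<eta> \<tau>)"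
    by (rule integral_spike[of "{b, b + 1}"]) auto
  also have "\<dots> \<le> integral {b..b + 1} (\<lambda>_. L)"
  proof (rule integral_le)
    have "speed A G ?\<eta> integrable_on {b..b + 1}"
      by (rule integrable_on_subinterval[OF int]) (use ab in auto)
    then show "(\<lambda>\<tau>. if \<tau> \<in> {b, b + 1} then L else speed A G ?\<eta> \<tau>) integrable_on {b..b + 1}"
      by (rule integrable_spike_finite[of "{b, b + 1}", rotated 2]) auto
    show "(if \<tau> \<in> {b, b + 1} then L else speed A G ?\<eta> \<tau>) \<le> L" if "\<tau> \<in> {b..b + 1}" for \<tau>
      using bound[of \<tau>] that by (cases "\<tau> \<in> {b, b + 1}") auto
  qed (rule integrable_const_ivl)
  finally have "integral {b..b + 1} (speed A G ?\<eta>) \<le> L" by simp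
  moreover have "integral {a..b} (speed A G ?\<eta>) + integral {b..b + 1} (speed A G ?\<eta>)
      = integral {a..b + 1} (speed A G ?\<eta>)"
    by (rule Henstock_Kurzweil_Integration.integral_combine[OF ab _ int]) simp
  ultimately show ?thesis using first unfolding curve_length_def by linarith
qed

text \<open>Balls are convex, so the coordinate segment from \<open>u\<close> to \<open>v\<close>
  stays in the chart and can be appended to any curve ending at the point with coordinates
  \<open>u\<close>, at cost at most \<open>C * norm (v - u)\<close>.\<close>

lemma riemannian_dist_append_line:
  assumes c: "c \<in> A" and uv: "u \<in> ball p r" "v \<in> ball p r" and sub: "ball p r \<subseteq> chart_image c"
    and C: "0 \<le> C" "\<And>q w. q \<in> ball p r \<Longrightarrow> sqrt (G c (chart_inv c q) w w) \<le> C * norm w"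
  shows "riemannian_dist A G x (chart_inv c v)
    \<le> riemannian_dist A G x (chart_inv c u) + ennreal (C * norm (v - u))"
proof -
  have line: "u + k *\<^sub>R (v - u) \<in> ball p r" if "0 \<le> k" "k \<le> 1" for k
  proof -
    have "u + k *\<^sub>R (v - u) = (1 - k) *\<^sub>R u + k *\<^sub>R v" by (simp add: algebra_simps)
    then show ?thesis using convexD_alt[OF convex_ball uv that] by simp
  qed
  have "riemannian_dist A G x (chart_inv c v)
      \<le> ennreal (C * norm (v - u)) + ennreal (curve_length A G a b \<gamma>)"
    if ab: "a \<le> b" and pw: "piecewise_C1_curve A a b \<gamma>"
      and ends: "\<gamma> a = x" "\<gamma> b = chart_inv c u" for a b \<gamma>
  proof -
    define \<eta> where "\<eta> = (\<lambda>\<tau>. if \<tau> \<le> b then \<gamma> \<tau> else chart_inv c (u + (\<tau> - b) *\<^sub>R (v - u)))"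
    have line': "u + (\<tau> - b) *\<^sub>R (v - u) \<in> ball p r" if "\<tau> \<in> {b..b + 1}" for \<tau>
      using line[of "\<tau> - b"] that by simp
    have "piecewise_C1_curve A a (b + 1) \<eta>"
      unfolding \<eta>_def using line' sub ends(2)
      by (intro piecewise_C1_curve_append_line[OF pw ab c]) auto
    then have "riemannian_dist A G x (chart_inv c v) \<le> ennreal (curve_length A G a (b + 1) \<eta>)"
      unfolding riemannian_dist_def
      by (intro Inf_lower CollectI exI[of _ a] exI[of _ "b + 1"] exI[of _ \<eta>])
        (use ab ends in \<open>simp add: \<eta>_def\<close>)
    also have "\<dots> \<le> ennreal (curve_length A G a b \<gamma> + C * norm (v - u))"
      unfolding \<eta>_def using line' sub ends(2) C(2)
      by (intro ennreal_leI curve_length_append_line[OF pw ab c]) auto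
    finally show ?thesis using C(1) curve_length_nonneg by (simp add: add.commute)
  qed
  \<comment> \<open>Moving the finite cost to the left gives a lower bound common to all curves,
    hence for their infimum; if there is no curve, the infimum is infinite and the bound is
    trivial.\<close>
  then have "riemannian_dist A G x (chart_inv c v) - ennreal (C * norm (v - u))
      \<le> riemannian_dist A G x (chart_inv c u)"
    unfolding riemannian_dist_def[of A G x "chart_inv c u"]
    by (intro Inf_greatest) (auto simp: ennreal_minus_le_iff)
  then show ?thesis by (simp add: ennreal_minus_le_iff add.commute)
qed

text \<open>Stands in for the triangle inequality: a short coordinate segment, run in either
  direction, changes the distance from any \<open>x\<close> by at most \<open>e\<close>. Written
  with sums, it also covers infinite distances.\<close>

lemma riemannian_dist_nearby:
  assumes "0 < e"
  shows "\<forall>\<^sub>F y in nhds p. \<forall>x.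
    riemannian_dist A G x y \<le> riemannian_dist A G x p + ennreal e \<and>
    riemannian_dist A G x p \<le> riemannian_dist A G x y + ennreal e"
proof -
  obtain c where c: "c \<in> A" "p \<in> fst c" using chart_cover .
  define q where "q = snd c p"
  have q: "q \<in> chart_image c" "chart_inv c q = p"
    using c chart_inv_left unfolding q_def chart_image_def by auto
  obtain r where r: "r > 0" "cball q r \<subseteq> chart_image c"
    using open_image[OF c(1)] q(1) open_contains_cball by meson
  obtain C where C: "C > 0"
    "\<And>u v. u \<in> cball q r \<Longrightarrow> sqrt (G c (chart_inv c u) v v) \<le> C * norm v"
    using metric_bounds[OF c(1) compact_cball r(2)] r(1)
    by (metis cball_eq_empty not_less_iff_gr_or_eq)
  \<comment> \<open>\<open>s \<le> r\<close> keeps the metric bound valid, and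
    \<open>C * s \<le> e\<close> keeps the segments short.\<close>
  define s where "s = min r (e / C)"
  have s: "s > 0" "s \<le> r" "C * s \<le> e" using r(1) C(1) assms unfolding s_def
    by (auto simp: field_simps min_def)
  have sub: "ball q s \<subseteq> chart_image c" using r(2) s(2) by force
  have near: "riemannian_dist A G x (chart_inv c v)
      \<le> riemannian_dist A G x (chart_inv c u) + ennreal e"
    if "u \<in> ball q s" "v \<in> ball q s" "norm (v - u) < s" for x u v
  proof -
    have "C * norm (v - u) \<le> C * s" using that(3) C(1) by simp
    then have le: "C * norm (v - u) \<le> e" using s(3) by linarith
    have "riemannian_dist A G x (chart_inv c v)
        \<le> riemannian_dist A G x (chart_inv c u) + ennreal (C * norm (v - u))"
      using C s(2) by (intro riemannian_dist_append_line[OF c(1) that(1,2) sub]) auto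
    also have "\<dots> \<le> riemannian_dist A G x (chart_inv c u) + ennreal e"
      using le by (intro add_left_mono ennreal_leI)
    finally show ?thesis .
  qed
  have "\<forall>\<^sub>F y in nhds p. y \<in> chart_inv c ` ball q s"
    using open_chart_ball[OF c(1) sub] q(2) s(1) by (intro eventually_nhds_in_open) force+
  then show ?thesis
  proof eventually_elim
    case (elim y)
    then obtain v where v: "v \<in> ball q s" "y = chart_inv c v" by blast
    moreover have "norm (v - q) < s" "norm (q - v) < s"
      using v(1) by (auto simp: dist_norm norm_minus_commute)
    ultimately show ?case
      using near[of q v] near[of v q] q(2) s(1) by simp
  qed
qed

lemma continuous_on_riemannian_dist: "continuous_on S (riemannian_dist A G x)"
proof -
  have "isCont (riemannian_dist A G x) p" for p
    unfolding isCont_def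
  proof (rule order_tendstoI)
    fix l assume "l < riemannian_dist A G x p"
    \<comment> \<open>A strict inequality in \<open>ennreal\<close> leaves room for a positive real
      \<open>e\<close>, even if the larger side is infinite.\<close>
    then obtain e :: real where e: "e > 0" "l + ennreal e < riemannian_dist A G x p"
      using ennreal_le_epsilon[of l "riemannian_dist A G x p"] by (meson not_le)
    have "\<forall>\<^sub>F y in nhds p. l < riemannian_dist A G x y"
      using riemannian_dist_nearby[OF e(1)]
    proof eventually_elim
      case (elim y)
      show ?case
      proof (rule ccontr)
        assume "\<not> l < riemannian_dist A G x y"
        then have "riemannian_dist A G x y + ennreal e \<le> l + ennreal e"
          by (intro add_right_mono) simp
        then show False using e(2) elim by (meson not_le order_trans)
      qed
    qed
    then show "\<forall>\<^sub>F y in at p. l < riemannian_dist A G x y"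
      by (simp add: eventually_at_filter eventually_mono)
  next
    fix l assume "riemannian_dist A G x p < l"
    then obtain e :: real where e: "e > 0" "riemannian_dist A G x p + ennreal e < l"
      using ennreal_le_epsilon[of "riemannian_dist A G x p" l] by (meson not_le)
    have "\<forall>\<^sub>F y in nhds p. riemannian_dist A G x y < l"
      using riemannian_dist_nearby[OF e(1)] by eventually_elim (meson e(2) le_less_trans)
    then show "\<forall>\<^sub>F y in at p. riemannian_dist A G x y < l"
      by (simp add: eventually_at_filter eventually_mono)
  qed
  then show ?thesis by (intro continuous_at_imp_continuous_on) auto
qed

end

section \<open>Centered and non-centered maximal functions\<close>

text \<open>The measure-theoretic core: the balls centred at \<open>x\<close> enter through their
  nesting, the other ball by containing \<open>x\<close> and having mass outside
  \<open>B x \<rho>\<close>.\<close>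

lemma maximal_functions_differ:
  fixes \<mu> :: "'a::{t2_space,second_countable_topology} measure"
    and A :: "('a, 'e::euclidean_space) chart set"
    and G :: "('a, 'e) metric_field"
  defines "B \<equiv> riemannian_ball A G"
  assumes finite: "\<And>x r. r > 0 \<Longrightarrow> emeasure \<mu> (B x r) < \<infinity>"
    and meas: "\<And>x r. B x r \<in> sets \<mu>"
    and pos: "s > 0" "\<rho> > 0" and x: "x \<in> B a s"
    and diff: "emeasure \<mu> (B a s - B x \<rho>) > 0" "emeasure \<mu> (B x \<rho> - B a s) > 0"
  obtains f where "integrable \<mu> f" "centered_maximal A G \<mu> f x < noncentered_maximal A G \<mu> f x"
proof -
  define E where "E = B a s - B x \<rho>"
  define F where "F = B x \<rho> - B a s"
  have fin: "emeasure \<mu> S < \<infinity>" if "S \<subseteq> B z r" "r > 0" for S z r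
    using emeasure_mono[OF that(1) meas] finite[OF that(2)] by (rule le_less_trans)
  have E: "E \<in> sets \<mu>" "emeasure \<mu> E < \<infinity>" and F: "F \<in> sets \<mu>" "emeasure \<mu> F < \<infinity>"
    unfolding E_def F_def using meas pos fin[OF Diff_subset] by auto
  have measure_pos: "measure \<mu> S > 0" if "emeasure \<mu> S > 0" "emeasure \<mu> S < \<infinity>" for S
    using that by (simp add: measure_def enn2real_positive_iff)
  have EF: "measure \<mu> E > 0" "measure \<mu> F > 0"
    using measure_pos diff E(2) F(2) unfolding E_def F_def by auto
  \<comment> \<open>With this weight the integrals over \<open>E\<close> and \<open>F\<close> cancel
    exactly.\<close>
  define K where "K = measure \<mu> E / measure \<mu> F"
  define f where "f = (\<lambda>y. indicator E y - K * indicator F y :: real)"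
  have f: "integrable \<mu> f"
    unfolding f_def using E F by (intro Bochner_Integration.integrable_diff integrable_mult_right) auto
  have set_int: "(LINT y:S|\<mu>. f y) = measure \<mu> (E \<inter> S) - K * measure \<mu> (F \<inter> S)"
    if "S \<in> sets \<mu>" for S
  proof -
    have fin: "emeasure \<mu> (E \<inter> S) < \<infinity>" "emeasure \<mu> (F \<inter> S) < \<infinity>"
      using E F that by (auto intro: le_less_trans[OF emeasure_mono])
    have "(LINT y:S|\<mu>. f y) = (\<integral>y. indicator (E \<inter> S) y - K * indicator (F \<inter> S) y \<partial>\<mu>)"
      unfolding set_lebesgue_integral_def f_def
      by (intro Bochner_Integration.integral_cong) (auto simp: indicator_def)
    also have "\<dots> = measure \<mu> (E \<inter> S) - K * measure \<mu> (F \<inter> S)"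
      using E(1) F(1) that fin sets.sets_into_space[OF E(1)] sets.sets_into_space[OF F(1)]
      by (subst Bochner_Integration.integral_diff) (auto simp: Int_absorb2 intro!: arg_cong[of _ _ "measure \<mu>"])
    finally show ?thesis .
  qed
  have "average \<mu> f (B x r) \<le> 0" if "r > 0" for r
  proof -
    have "(LINT y:B x r|\<mu>. f y) \<le> 0"
    proof (cases "r \<le> \<rho>")
      case True
      then have "E \<inter> B x r = {}"
        unfolding E_def B_def riemannian_ball_def
        by (auto dest: order_trans[OF _ ennreal_leI[OF True]])
      then show ?thesis using EF by (simp add: set_int[OF meas] K_def)
    next
      case False
      \<comment> \<open>A larger centred ball collects the entire negative part of \<open>f\<close>
        and at most the entire positive part.\<close>
      then have "F \<inter> B x r = F"
        unfolding F_def B_def riemannian_ball_def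
        by (auto intro: order_trans[OF _ ennreal_leI[of \<rho> r]])
      moreover have "measure \<mu> (E \<inter> B x r) \<le> measure \<mu> E"
        using E meas by (intro measure_mono_fmeasurable) (auto simp: fmeasurable_def)
      ultimately show ?thesis using EF by (simp add: set_int[OF meas] K_def)
    qed
    \<comment> \<open>This includes balls of measure zero, where the quotient is 0.\<close>
    then show ?thesis unfolding average_def by (simp add: divide_nonpos_nonneg)
  qed
  then have "centered_maximal A G \<mu> f x \<le> 0"
    unfolding centered_maximal_def B_def by (intro Sup_least) auto
  also have "0 < ereal (average \<mu> f (B a s))"
  proof -
    have "E \<inter> B a s = E" "F \<inter> B a s = {}" unfolding E_def F_def by auto
    then have "(LINT y:B a s|\<mu>. f y) = measure \<mu> E" using set_int[OF meas, of a s] by simp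
    moreover have "emeasure \<mu> (B a s) > 0"
      using diff(1) emeasure_mono[OF Diff_subset meas] by (rule less_le_trans)
    then have "measure \<mu> (B a s) > 0" by (rule measure_pos[OF _ finite[OF pos(1)]])
    ultimately show ?thesis using EF(1) unfolding average_def by simp
  qed
  also have "ereal (average \<mu> f (B a s)) \<le> noncentered_maximal A G \<mu> f x"
    unfolding noncentered_maximal_def
    by (rule Sup_upper) (use x pos(1) in \<open>auto simp: B_def\<close>)
  finally show thesis using that f by blast
qed

text \<open>On a curve through \<open>a\<close>, let \<open>x\<close> be the last point at distance \<open>D\<close> from \<open>a\<close>: the
  points \<open>b\<close> right after \<open>x\<close> are further away from \<open>a\<close> but close to \<open>x\<close>.\<close>

lemma (in riemannian_manifold) curve_three_points:
  fixes \<gamma> :: "real \<Rightarrow> 'a"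
  assumes cont: "continuous_on {s..t} \<gamma>" and ends: "s \<le> t" "\<gamma> s \<noteq> \<gamma> t"
  obtains a x b D \<rho> where "{a, x, b} \<subseteq> \<gamma> ` {s..t}" "0 < D" "0 < \<rho>"
    "riemannian_dist A G a x = ennreal D" "ennreal D < riemannian_dist A G a b"
    "riemannian_dist A G x b < ennreal \<rho>" "ennreal \<rho> < riemannian_dist A G x a"
proof -
  define h where "h = (\<lambda>\<tau>. riemannian_dist A G (\<gamma> s) (\<gamma> \<tau>))"
  have h: "continuous_on {s..t} h" unfolding h_def
    by (rule continuous_on_compose2[OF continuous_on_riemannian_dist cont]) (rule subset_UNIV)
  \<comment> \<open>Distances are extended values; this supplies real radii strictly below a
    positive one.\<close>
  have small: "\<exists>r::real. 0 < r \<and> ennreal r < z" if "0 < z" for z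
  proof (rule ccontr)
    assume "\<not> ?thesis"
    then have "z \<le> 0 + ennreal r" if "0 < r" for r using that by (metis add_0 not_less)
    then have "z \<le> 0" by (rule ennreal_le_epsilon)
    with \<open>0 < z\<close> show False by simp
  qed
  have "0 < h t" unfolding h_def by (rule riemannian_dist_pos[OF ends(2)])
  then obtain D where D: "0 < D" "ennreal D < h t" using small by blast
  define E where "E = {s..t} \<inter> h -` {ennreal D}"
  have "closed E" unfolding E_def by (rule continuous_closed_preimage[OF h]) auto
  moreover have "bounded E"
    unfolding E_def by (rule bounded_subset[OF bounded_closed_interval]) auto
  ultimately have "compact E" by (simp add: compact_eq_bounded_closed)
  moreover have "E \<noteq> {}"
    using IVT'[of h s "ennreal D" t] D ends(1) h riemannian_dist_self unfolding E_def h_def by force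
  ultimately obtain \<tau> where \<tau>: "\<tau> \<in> E" "\<And>u. u \<in> E \<Longrightarrow> u \<le> \<tau>"
    using compact_attains_sup[of E] by blast
  have \<tau>': "s \<le> \<tau>" "\<tau> < t" "h \<tau> = ennreal D" using \<tau>(1) D(2) unfolding E_def by (auto simp: less_le)
  \<comment> \<open>Otherwise the intermediate value theorem on \<open>{u..t}\<close> would give a
    time in \<open>E\<close> later than \<open>\<tau>\<close>.\<close>
  have after: "ennreal D < h u" if u: "u \<in> {\<tau><..t}" for u
  proof (rule ccontr)
    assume "\<not> ennreal D < h u"
    then have "h u \<le> ennreal D" by simp
    moreover have "continuous_on {u..t} h" using h u \<tau>' by (auto elim: continuous_on_subset)
    ultimately obtain w where "u \<le> w" "w \<le> t" "h w = ennreal D"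
      using IVT'[of h u "ennreal D" t] u less_imp_le[OF D(2)] by auto
    then have "w \<in> E" using u \<tau>' unfolding E_def by auto
    then show False using \<tau>(2) u \<open>u \<le> w\<close> by fastforce
  qed
  have "h \<tau> \<noteq> h s" using \<tau>'(3) D(1) riemannian_dist_self unfolding h_def by simp
  \<comment> \<open>Here the distance is taken from \<open>\<gamma> \<tau>\<close>. Positivity is
    applied in this order too, so symmetry of the distance is never invoked.\<close>
  then have "0 < riemannian_dist A G (\<gamma> \<tau>) (\<gamma> s)" unfolding h_def by (intro riemannian_dist_pos) auto
  then obtain \<rho> where \<rho>: "0 < \<rho>" "ennreal \<rho> < riemannian_dist A G (\<gamma> \<tau>) (\<gamma> s)"
    using small by blast
  have "open {y. riemannian_dist A G (\<gamma> \<tau>) y < ennreal \<rho>}"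
    using open_Collect_less[OF continuous_on_riemannian_dist continuous_on_const] .
  moreover have "\<gamma> \<tau> \<in> {y. riemannian_dist A G (\<gamma> \<tau>) y < ennreal \<rho>}"
    using \<rho>(1) by (simp add: riemannian_dist_self)
  ultimately obtain d where d: "d > 0"
    "\<gamma> ` ({s..t} \<inter> ball \<tau> d) \<subseteq> {y. riemannian_dist A G (\<gamma> \<tau>) y < ennreal \<rho>}"
    using continuous_curve_local[OF cont, of \<tau> "{}"] \<tau>' by (metis atLeastAtMost_iff finite.emptyI less_imp_le)
  \<comment> \<open>Slightly after \<open>\<tau>\<close>, but no later than \<open>t\<close>; since
    \<open>\<tau> < t\<close>, this is strictly after \<open>\<tau>\<close>.\<close>
  define u where "u = min t (\<tau> + d / 2)"
  have u: "u \<in> {\<tau><..t}" "u \<in> ball \<tau> d"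
    using \<tau>' d(1) unfolding u_def by (auto simp: dist_real_def min_def)
  show thesis
  proof (rule that[of "\<gamma> s" "\<gamma> \<tau>" "\<gamma> u" D \<rho>])
    show "{\<gamma> s, \<gamma> \<tau>, \<gamma> u} \<subseteq> \<gamma> ` {s..t}" using \<tau>' u ends(1) by auto
    show "riemannian_dist A G (\<gamma> \<tau>) (\<gamma> u) < ennreal \<rho>" using d(2) u \<tau>'(1) by (auto simp: image_subset_iff)
    show "ennreal D < riemannian_dist A G (\<gamma> s) (\<gamma> u)" using after[OF u(1)] unfolding h_def by simp
  qed (use \<tau>'(3) D \<rho> in \<open>simp_all add: h_def\<close>)
qed

theorem corollary1p4:
  fixes A :: "('a::{t2_space,second_countable_topology}, 'e::euclidean_space) chart set"
    and G :: "('a, 'e) metric_field"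
    and \<mu> :: "'a measure"
    and J :: "real set"
    and \<gamma> :: "real \<Rightarrow> 'a"
  assumes "riemannian_manifold A G"
    and "sets \<mu> = sets borel"
    and "continuous_measure \<mu>"
    and "\<And>x r. r > 0 \<Longrightarrow> emeasure \<mu> (riemannian_ball A G x r) < \<infinity>"
    and "is_interval J"
    and "geodesic_on A G J \<gamma>"
    and "\<exists>s\<in>J. \<exists>t\<in>J. \<gamma> s \<noteq> \<gamma> t"
    and "\<gamma> ` J \<subseteq> measure_support \<mu>"
  shows "\<exists>f :: 'a \<Rightarrow> real. integrable \<mu> f \<and>
           (\<exists>x \<in> measure_support \<mu>. noncentered_maximal A G \<mu> f x \<noteq> centered_maximal A G \<mu> f x)"
proof -
  interpret riemannian_manifold A G by (rule assms(1))
  obtain s' t' where J: "s' \<in> J" "t' \<in> J" "\<gamma> s' \<noteq> \<gamma> t'"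
    using assms(7) by blast
  define s t where "s = min s' t'" and "t = max s' t'"
  have st: "s \<in> J" "t \<in> J" "s \<le> t" "\<gamma> s \<noteq> \<gamma> t"
    using J unfolding s_def t_def by (auto simp: min_def max_def)
  have sub: "{s..t} \<subseteq> J" using mem_is_interval_1_I[OF assms(5) st(1,2)] by auto
  have "continuous_on {s..t} \<gamma>"
    using assms(6) sub unfolding geodesic_on_def by (blast intro: continuous_on_subset)
  then obtain a x b D \<rho> where pts: "{a, x, b} \<subseteq> \<gamma> ` {s..t}" and pos: "0 < D" "0 < \<rho>"
    and dist: "riemannian_dist A G a x = ennreal D" "ennreal D < riemannian_dist A G a b"
      "riemannian_dist A G x b < ennreal \<rho>" "ennreal \<rho> < riemannian_dist A G x a"
    using curve_three_points st(3,4) by blast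
  have supp: "a \<in> measure_support \<mu>" "x \<in> measure_support \<mu>" "b \<in> measure_support \<mu>"
    using pts sub assms(8) by blast+
  \<comment> \<open>Continuity of the distance makes the balls closed, hence Borel.\<close>
  have meas: "riemannian_ball A G z r \<in> sets \<mu>" for z r
    unfolding assms(2) riemannian_ball_def
    by (intro borel_closed closed_Collect_le continuous_on_riemannian_dist continuous_on_const)
  \<comment> \<open>The strict inequalities cut out an open set around the support point
    \<open>p\<close> that lies inside the difference of the two closed balls.\<close>
  have annulus: "emeasure \<mu> (riemannian_ball A G y r - riemannian_ball A G z q) > 0"
    if "p \<in> measure_support \<mu>" "riemannian_dist A G y p < ennreal r"
      "ennreal q < riemannian_dist A G z p" for p y z r q
  proof -
    let ?U = "{w. riemannian_dist A G y w < ennreal r} \<inter> {w. ennreal q < riemannian_dist A G z w}"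
    have "open ?U"
      by (intro open_Int open_Collect_less continuous_on_riemannian_dist continuous_on_const)
    then have "0 < emeasure \<mu> ?U" using that unfolding measure_support_def by blast
    also have "\<dots> \<le> emeasure \<mu> (riemannian_ball A G y r - riemannian_ball A G z q)"
      using meas by (intro emeasure_mono) (auto simp: riemannian_ball_def)
    finally show ?thesis .
  qed
  obtain f where "integrable \<mu> f" "centered_maximal A G \<mu> f x < noncentered_maximal A G \<mu> f x"
  \<comment> \<open>The ball around \<open>a\<close> has \<open>x\<close> exactly at distance
    \<open>D\<close>; the support points \<open>a\<close> and \<open>b\<close> give positive mass to
    the two differences.\<close>
  proof (rule maximal_functions_differ[of \<mu> A G D \<rho> x a])
    show "emeasure \<mu> (riemannian_ball A G a D - riemannian_ball A G x \<rho>) > 0"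
      using annulus[OF supp(1)] dist(4) pos(1) by (simp add: riemannian_dist_self)
    show "emeasure \<mu> (riemannian_ball A G x \<rho> - riemannian_ball A G a D) > 0"
      using annulus[OF supp(3) dist(3,2)] .
    show "x \<in> riemannian_ball A G a D" using dist(1) by (simp add: riemannian_ball_def)
  qed (use assms(4) meas pos in blast)+
  then show ?thesis using supp(2) by (metis order_less_irrefl)
qed

end
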